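(* There exists a (deterministic) algorithm that, for any $0<\varepsilon<1$ and any $n$, constructs an $\varepsilon$-synchronization string of length $n$ over an alphabet of size $\varepsilon^{-O(1)}$ in $O(n)$ time.
   Context: The edit distance $ED(a,b)$ of two strings is the minimum number of insertions and deletions of single symbols needed to transform $a$ into $b$. $S[i,j)$ denotes the substring of $S$ from position $i$ up to but not including position $j$. A string $S\in\Sigma^n$ is an $\varepsilon$-synchronization string if for every $1\le i<j<k\le n+1$, $ED(S[i,j),S[j,k))>(1-\varepsilon)(k-i)$. Running times are in the standard RAM model; $\varepsilon$ is a fixed constant and hidden constants in the running time may depend on $\varepsilon$. *)

theory Defs
  imports Complex_Main "HOL-Library.Landau_Symbols"
begin

definition edit_step :: "'a list \<Rightarrow> 'a list \<Rightarrow> bool" where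
  "edit_step xs ys \<longleftrightarrow>
     (\<exists>us a vs. xs = us @ vs \<and> ys = us @ a # vs \<or> xs = us @ a # vs \<and> ys = us @ vs)"

definition ED :: "'a list \<Rightarrow> 'a list \<Rightarrow> nat" where
  "ED xs ys = (LEAST k. (edit_step ^^ k) xs ys)"

text \<open>\<open>substr S i j\<close> is \<open>S[i,j)\<close> with positions counted from 1, so it is only meaningful for \<open>1 \<le> i\<close>.\<close>

definition substr :: "'a list \<Rightarrow> nat \<Rightarrow> nat \<Rightarrow> 'a list" where
  "substr S i j = take (j - i) (drop (i - 1) S)"

definition sync_string :: "real \<Rightarrow> 'a list \<Rightarrow> bool" where
  "sync_string \<epsilon> S \<longleftrightarrow>
     (\<forall>i j k. 1 \<le> i \<and> i < j \<and> j < k \<and> k \<le> length S + 1 \<longrightarrow>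
        real (ED (substr S i j) (substr S j k)) > (1 - \<epsilon>) * (real k - real i))"

text \<open>
  A random access machine with finitely many instructions, memory cells holding natural numbers,
  indirect addressing and a write-only output tape. Operands are cell addresses, the destination
  coming first; only \<open>Const\<close> takes an immediate value, and jump targets are instruction indices.
  \<open>Load d a\<close> reads, and \<open>Store a s\<close> writes, the cell whose address is stored in cell \<open>a\<close>.
  Subtraction is truncated at 0 and division rounds down (division by 0 gives 0).
  The machine halts when the program counter leaves the program.
\<close>

datatype instr =
    Const nat nat
  | Copy nat nat
  | Load nat nat
  | Store nat nat
  | Add nat nat nat
  | Sub nat nat nat
  | Mul nat nat nat
  | Div nat nat nat
  | Jump nat
  | JumpLess nat nat nat
  | Print nat

datatype config = Config (pc: nat) (mem: "nat \<Rightarrow> nat") (out: "nat list")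

fun exec :: "instr \<Rightarrow> config \<Rightarrow> config" where
  "exec (Const d v) (Config p m os) = Config (p + 1) (m(d := v)) os"
| "exec (Copy d s) (Config p m os) = Config (p + 1) (m(d := m s)) os"
| "exec (Load d a) (Config p m os) = Config (p + 1) (m(d := m (m a))) os"
| "exec (Store a s) (Config p m os) = Config (p + 1) (m(m a := m s)) os"
| "exec (Add d s t) (Config p m os) = Config (p + 1) (m(d := m s + m t)) os"
| "exec (Sub d s t) (Config p m os) = Config (p + 1) (m(d := m s - m t)) os"
| "exec (Mul d s t) (Config p m os) = Config (p + 1) (m(d := m s * m t)) os"
| "exec (Div d s t) (Config p m os) = Config (p + 1) (m(d := m s div m t)) os"
| "exec (Jump l) (Config p m os) = Config l m os"
| "exec (JumpLess s t l) (Config p m os) = Config (if m s < m t then l else p + 1) m os"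
| "exec (Print s) (Config p m os) = Config (p + 1) m (os @ [m s])"

definition halted :: "instr list \<Rightarrow> config \<Rightarrow> bool" where
  "halted P c \<longleftrightarrow> length P \<le> pc c"

definition step :: "instr list \<Rightarrow> config \<Rightarrow> config" where
  "step P c = (if halted P c then c else exec (P ! pc c) c)"

definition init_config :: "nat list \<Rightarrow> config" where
  "init_config xs = Config 0 (\<lambda>a. if a < length xs then xs ! a else 0) []"

text \<open>
  On input \<open>xs\<close> the program halts with output \<open>ys\<close> after executing at most \<open>T\<close> instructions,
  and never holds a number of more than \<open>w\<close> bits. The word-length bound is what makes
  charging one time unit per arithmetic operation legitimate.
\<close>

definition ram_computes ::
    "instr list \<Rightarrow> nat list \<Rightarrow> nat list \<Rightarrow> nat \<Rightarrow> nat \<Rightarrow> bool" where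
  "ram_computes P xs ys T w \<longleftrightarrow>
     (\<exists>t\<le>T. halted P ((step P ^^ t) (init_config xs)) \<and>
            out ((step P ^^ t) (init_config xs)) = ys \<and>
            (\<forall>s\<le>t. \<forall>a. mem ((step P ^^ s) (init_config xs)) a < 2 ^ w))"

text \<open>
  A real \<open>\<epsilon>\<close> is not a possible input of the machine; it is presented by the integer
  \<open>\<lceil>1/\<epsilon>\<rceil>\<close>. The algorithm thus gets less information than \<open>\<epsilon>\<close> itself (and this integer can be
  computed from any fraction representing \<open>\<epsilon>\<close> in time independent of \<open>n\<close>).
\<close>

definition sync_input :: "real \<Rightarrow> nat \<Rightarrow> nat list" where
  "sync_input \<epsilon> n = [nat \<lceil>1 / \<epsilon>\<rceil>, n]"

end

theory Submission
  imports Defs "HOL-Library.Sublist" "HOL-Real_Asymp.Real_Asymp"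
begin

text \<open>
  Fix a block length \<open>l\<close>. A symbol \<open>s < B\<^sup>2\<close>, \<open>B = (2l)\<^sup>4\<close>, is read as the linear function with
  coefficients \<open>s div B\<close> and \<open>s mod B\<close> and is encoded by the block whose \<open>d\<close>-th symbol is the pair of
  \<open>d\<close> and the value at \<open>d\<close>. As \<open>l\<^sup>2B\<close> is much smaller than \<open>B\<^sup>2\<close>, this shrinks the alphabet, from
  \<open>(2l)\<^sup>8\<close> to \<open>l\<^sup>8\<close> symbols; two different blocks agree in at most one place. Encoding the same kind
  of word for \<open>2l\<close> symbol by symbol gives an infinite word for \<open>l\<close>, in which equal symbols occur
  only at positions congruent modulo \<open>l\<close>.

  In a monotone matching between adjacent factors of total length \<open>L\<close>, each pair of distinct blocks
  contributes at most one matched pair and at most \<open>L/l + 2\<close> such block pairs meet. The pairs that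
  lie in blocks with equal symbols are split by their residue modulo \<open>l\<close>: each residue class yields
  a matching of adjacent factors one level up, and the total length of all these factors is \<open>L\<close>.
  So the relative losses \<open>3/l + 3/(2l) + 3/(4l) + \<dots>\<close> add up to at most \<open>6/l\<close>.

  The word is written down by an odometer that stores the current symbol of each level; the next
  symbol costs amortized constant time, the potential being the number of nonzero digits.
\<close>

section \<open>The word and its matchings\<close>

definition enc :: "nat \<Rightarrow> nat \<Rightarrow> nat \<Rightarrow> nat" where
  "enc l s d = d + l * (s div (2 * l) ^ 4 + s mod (2 * l) ^ 4 * d)"

text \<open>The guards make \<open>p div l\<close> smaller than \<open>p\<close>; the value 0 at
  \<open>p = 0\<close> agrees with the recursion because \<open>enc l 0 0 = 0\<close>.\<close>

function word :: "nat \<Rightarrow> nat \<Rightarrow> nat" where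
  "word l p = (if l < 2 \<or> p = 0 then 0 else enc l (word (2 * l) (p div l)) (p mod l))"
  by auto
termination by (relation "measure snd") auto

declare word.simps [simp del]

lemma word_0 [simp]: "word l 0 = 0"
  by (simp add: word.simps)

lemma word_rec: "2 \<le> l \<Longrightarrow> word l p = enc l (word (2 * l) (p div l)) (p mod l)"
  by (cases "p = 0") (simp_all add: word.simps [of l p] enc_def)

lemma enc_mod: "d < l \<Longrightarrow> enc l s d mod l = d"
  by (simp add: enc_def)

lemma word_mod: "2 \<le> l \<Longrightarrow> word l p mod l = p mod l"
  by (simp add: word_rec [of l p] enc_mod)

text \<open>Both coefficients are below \<open>B = (2 * l) ^ 4\<close>, so every code is below
  \<open>l * l * B = 16 * l ^ 6\<close>, which \<open>4 \<le> l\<close> turns into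
  \<open>l ^ 8\<close>.\<close>

lemma enc_less:
  assumes "4 \<le> l" "s < (2 * l) ^ 8" "d < l"
  shows "enc l s d < l ^ 8"
proof -
  define B where "B = (2 * l) ^ 4"
  have B: "B > 0" "s < B * B"
    using assms by (simp_all add: B_def flip: power_add)
  have "s div B \<le> B - 1" "s mod B \<le> B - 1"
    using B by (auto simp: less_mult_imp_div_less less_Suc_eq_le [symmetric])
  then have "s div B + s mod B * d \<le> (B - 1) + (B - 1) * (l - 1)"
    using assms(3) by (intro add_mono mult_mono) auto
  also have "\<dots> = (B - 1) * l"
    using assms(1) by (cases l) auto
  finally have "enc l s d \<le> d + l * ((B - 1) * l)"
    unfolding enc_def B_def [symmetric] by simp
  also have "\<dots> < l * l + l * ((B - 1) * l)"
    using assms(3) by (metis add_strict_right_mono le_square order_less_le_trans)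
  also have "\<dots> = l * l * B"
    using B(1) by (cases B) (auto simp: algebra_simps)
  also have "\<dots> = 16 * l ^ 6"
    unfolding B_def by algebra
  also have "\<dots> \<le> l ^ 2 * l ^ 6"
    using power_mono [OF assms(1), of 2] by (intro mult_right_mono) auto
  also have "\<dots> = l ^ 8"
    by (simp flip: power_add)
  finally show ?thesis .
qed

lemma word_less: "4 \<le> l \<Longrightarrow> word l p < l ^ 8"
proof (induction p arbitrary: l rule: less_induct)
  case (less p)
  show ?case
  proof (cases "p = 0")
    case False
    with less.IH [of "p div l" "2 * l"] less.prems have "word (2 * l) (p div l) < (2 * l) ^ 8"
      by simp
    then show ?thesis
      using less.prems by (simp add: word_rec [of l p] enc_less)
  qed (use less.prems in simp)
qed

text \<open>Two linear functions with the same values at two distinct integers have the same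
  coefficients, and these determine the symbol.\<close>

lemma enc_agree_once:
  assumes "d < l" "e < l" "d \<noteq> e" "enc l s d = enc l t d" "enc l s e = enc l t e"
  shows "s = t"
proof -
  define B where "B = (2 * l) ^ 4"
  have d: "s div B + s mod B * d = t div B + t mod B * d"
    and e: "s div B + s mod B * e = t div B + t mod B * e"
    using assms unfolding enc_def B_def [symmetric] by auto
  have "(int (s mod B) - int (t mod B)) * (int d - int e) = 0"
    using arg_cong [OF d, of int] arg_cong [OF e, of int] by (simp add: algebra_simps)
  then have "s mod B = t mod B"
    using assms(3) by simp
  moreover from this d have "s div B = t div B" by simp
  ultimately show ?thesis by (metis div_mult_mod_eq)
qed

section \<open>Counting positions in a residue class\<close>

text \<open>The summand is the number of positions below \<open>x\<close> with residue
  \<open>d\<close>. In the reversed sum, raising \<open>x\<close> by one shifts a window of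
  \<open>l\<close> consecutive terms, which drops \<open>x div l\<close> and gains
  \<open>(x + l) div l\<close>.\<close>

lemma sum_residue_counts:
  fixes l x :: nat
  assumes "0 < l"
  shows "(\<Sum>d<l. (x + (l - Suc d)) div l) = x"
proof -
  have "(\<Sum>d<l. (x + d) div l) = x"
  proof (induction x)
    case 0
    then show ?case by (intro sum.neutral) auto
  next
    case (Suc x)
    have "(\<Sum>d<l. (Suc x + d) div l) + x div l = (\<Sum>d<Suc l. (x + d) div l)"
      by (subst sum.lessThan_Suc_shift) simp
    also have "\<dots> = x + (x + l) div l"
      using Suc by simp
    finally show ?case using assms by simp
  qed
  then show ?thesis
    by (subst sum.nat_diff_reindex) simp
qed

text \<open>The members of a residue class are numbered by their quotients, so a cut at
  \<open>x\<close> becomes a cut of the quotients at the count for \<open>x\<close>.\<close>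

lemma less_iff_div_less_count:
  fixes l x p :: nat
  assumes "0 < l"
  shows "p < x \<longleftrightarrow> p div l < (x + (l - Suc (p mod l))) div l"
proof -
  define u where "u = p div l"
  define d where "d = p mod l"
  have p: "p = u * l + d" and d: "d < l"
    using assms by (simp_all add: u_def d_def)
  have "u < (x + (l - Suc d)) div l \<longleftrightarrow> Suc u * l \<le> x + (l - Suc d)"
    using assms by (simp add: less_eq_div_iff_mult_less_eq flip: Suc_le_eq)
  then show ?thesis
    using d unfolding u_def [symmetric] d_def [symmetric] p by auto
qed

section \<open>Size of monotone matchings\<close>

text \<open>Used for two pairs in both orders, the equivalence also gives \<open>p = p'\<close> iff
  \<open>q = q'\<close>, so no position is matched twice.\<close>

definition chain :: "(nat \<times> nat) set \<Rightarrow> bool" where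
  "chain M \<longleftrightarrow> (\<forall>(p, q) \<in> M. \<forall>(p', q') \<in> M. (p < p' \<longleftrightarrow> q < q'))"

definition matching :: "(nat \<Rightarrow> nat) \<Rightarrow> nat \<Rightarrow> nat \<Rightarrow> nat \<Rightarrow> (nat \<times> nat) set \<Rightarrow> bool" where
  "matching f i j k M \<longleftrightarrow> chain M \<and> M \<subseteq> {i..<j} \<times> {j..<k} \<and> (\<forall>(p, q) \<in> M. f p = f q)"

lemma chainD: "chain M \<Longrightarrow> (p, q) \<in> M \<Longrightarrow> (p', q') \<in> M \<Longrightarrow> p < p' \<longleftrightarrow> q < q'"
  by (auto simp: chain_def)

lemma word_eqD: "2 \<le> l \<Longrightarrow> word l p = word l q \<Longrightarrow> p mod l = q mod l"
  by (metis word_mod)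

text \<open>Matched positions have the same offset in their blocks. Two matched pairs at different
  offsets would make the blocks agree twice and so force equal symbols.\<close>

lemma word_eq_div_eq:
  assumes "2 \<le> l" "word l p = word l q" "word l p' = word l q'"
    and "p div l = p' div l" "q div l = q' div l" "word (2 * l) (p div l) \<noteq> word (2 * l) (q div l)"
  shows "p = p' \<and> q = q'"
proof -
  have m: "p mod l = q mod l" "p' mod l = q' mod l"
    using assms(1-3) by (auto intro: word_eqD)
  have "p mod l = p' mod l"
  proof (rule ccontr)
    assume "p mod l \<noteq> p' mod l"
    moreover have "p mod l < l" "p' mod l < l" using assms(1) by simp_all
    ultimately have "word (2 * l) (p div l) = word (2 * l) (q div l)"
      using enc_agree_once [of "p mod l" l "p' mod l"] assms(2-5) m
      unfolding word_rec [OF assms(1), of p] word_rec [OF assms(1), of q]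
        word_rec [OF assms(1), of p'] word_rec [OF assms(1), of q'] by metis
    with assms(6) show False ..
  qed
  with assms(4,5) m show ?thesis by (metis div_mult_mod_eq)
qed

text \<open>Pairs in blocks with different symbols (\<open>D\<close>) and with equal symbols
  (\<open>S\<close>) each number at most \<open>3 * (k - i) / l\<close>: the former by counting
  block pairs, the latter by induction at \<open>2 * l\<close>, where the constant 6 is
  halved.\<close>

lemma card_matching_le:
  "2 \<le> l \<Longrightarrow> matching (word l) i j k M \<Longrightarrow> l * card M \<le> 6 * (k - i)"
proof (induction k arbitrary: l i j M rule: less_induct)
  case (less k)
  note l = \<open>2 \<le> l\<close>
  have chain: "chain M" and sub: "M \<subseteq> {i..<j} \<times> {j..<k}"
    and eq: "\<And>p q. (p, q) \<in> M \<Longrightarrow> word l p = word l q"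
    using less.prems(2) by (auto simp: matching_def)
  have fin: "finite M" using sub by (rule finite_subset) auto
  have mods: "p mod l = q mod l" if "(p, q) \<in> M" for p q
    using l eq [OF that] by (rule word_eqD)
  show ?case
  proof (cases "M = {}")
    case False
    then obtain p q where pq: "(p, q) \<in> M" by auto
    then have ord: "i \<le> p" "p < j" "j \<le> q" "q < k" using sub by auto
    \<comment> \<open>Matched positions are distinct and congruent modulo \<open>l\<close>, so a
      nonempty matching forces \<open>l < k - i\<close>. This later absorbs the additive terms
      caused by incomplete blocks.\<close>
    have "l dvd q - p"
      using mods [OF pq] ord by (metis mod_eq_dvd_iff_nat less_imp_le_nat order_less_le_trans)
    then have "l \<le> q - p" using ord by (intro dvd_imp_le) auto
    then have lL: "l < k - i" using ord by linarith
    define g where "g = (\<lambda>(p, q). (p div l, q div l))"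
    define S where "S = {(p, q) \<in> M. word (2 * l) (p div l) = word (2 * l) (q div l)}"
    define D where "D = M - S"
    \<comment> \<open>Both block numbers grow weakly along the chain, so their sum determines the
      two blocks, and these contain at most one pair of \<open>D\<close>.\<close>
    have "inj_on (\<lambda>(p, q). p div l + q div l) D"
    proof (rule inj_onI, clarify)
      fix p q p' q'
      assume a: "(p, q) \<in> D" "(p', q') \<in> D" "p div l + q div l = p' div l + q' div l"
      then have M: "(p, q) \<in> M" "(p', q') \<in> M" by (auto simp: D_def)
      have "p div l = p' div l \<and> q div l = q' div l"
      proof (cases "p < p'")
        case True
        then have "q < q'" using chainD [OF chain M] by simp
        with True a(3) show ?thesis
          using div_le_mono [of p p' l] div_le_mono [of q q' l] by simp
      next
        case False
        then have "q' \<le> q" using chainD [OF chain M] by simp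
        with False a(3) show ?thesis
          using div_le_mono [of p' p l] div_le_mono [of q' q l] by simp
      qed
      with a(1) M eq show "p = p' \<and> q = q'"
        by (intro word_eq_div_eq [OF l]) (auto simp: D_def S_def)
    qed
    moreover have "(\<lambda>(p, q). p div l + q div l) ` D
        \<subseteq> {i div l + j div l .. (j - 1) div l + (k - 1) div l}"
    proof clarify
      fix p q assume "(p, q) \<in> D"
      then have "i \<le> p" "p \<le> j - 1" "j \<le> q" "q \<le> k - 1"
        using subsetD [OF sub, of "(p, q)"] by (auto simp: D_def)
      then show "p div l + q div l \<in> {i div l + j div l .. (j - 1) div l + (k - 1) div l}"
        by (auto intro!: add_mono div_le_mono)
    qed
    ultimately have "card D \<le> Suc ((j - 1) div l + (k - 1) div l) - (i div l + j div l)"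
      by (metis card_atLeastAtMost card_inj_on_le finite_atLeastAtMost)
    \<comment> \<open>The contributions of the common border cancel, as
      \<open>(j - 1) div l \<le> j div l\<close>.\<close>
    also have "\<dots> \<le> Suc ((k - 1) div l) - i div l"
      using div_le_mono [of "j - 1" j l] by simp
    finally have "l * card D \<le> l * (Suc ((k - 1) div l) - i div l)"
      by (rule mult_le_mono2)
    also have "\<dots> = l + l * ((k - 1) div l) - l * (i div l)"
      by (simp add: diff_mult_distrib2)
    also have "\<dots> \<le> 3 * (k - i)"
    proof -
      have "i < l * (i div l) + l"
        using l mult_div_mod_eq [of l i] mod_less_divisor [of l i] by linarith
      moreover have "l * ((k - 1) div l) \<le> k - 1" by simp
      ultimately show ?thesis using lL by linarith
    qed
    finally have D: "l * card D \<le> 3 * (k - i)" .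
    \<comment> \<open>\<open>c d x\<close> counts the positions below \<open>x\<close> with residue
      \<open>d\<close>. Division by \<open>l\<close> sends class \<open>d\<close> of the two factors
      to the adjacent intervals cut at \<open>c d i\<close>, \<open>c d j\<close> and
      \<open>c d k\<close>.\<close>
    define c where "c = (\<lambda>d x. (x + (l - Suc d)) div l)"
    define R where "R = (\<lambda>d. {(p, q) \<in> S. p mod l = d})"
    have R: "2 * l * card (R d) \<le> 6 * (c d k - c d i)" if "d < l" for d
    proof -
      have RD: "(p, q) \<in> M" "word (2 * l) (p div l) = word (2 * l) (q div l)"
        "p mod l = d" "q mod l = d" if "(p, q) \<in> R d" for p q
        using that mods by (auto simp: R_def S_def)
      have cnt: "p < x \<longleftrightarrow> p div l < c d x" if "p mod l = d" for p x
        unfolding c_def using less_iff_div_less_count [of l p x] l that by simp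
      have "inj_on g (R d)"
      proof (rule inj_onI, clarify)
        fix p q p' q' assume R: "(p, q) \<in> R d" "(p', q') \<in> R d" and "g (p, q) = g (p', q')"
        then have "p div l = p' div l" "q div l = q' div l" by (simp_all add: g_def)
        with RD(3,4) [OF R(1)] RD(3,4) [OF R(2)] show "p = p' \<and> q = q'"
          by (metis div_mult_mod_eq)
      qed
      then have "card (R d) = card (g ` R d)"
        by (simp add: card_image)
      moreover have "2 * l * card (g ` R d) \<le> 6 * (c d k - c d i)"
      proof (rule less.IH)
        \<comment> \<open>The induction needs \<open>c d k < k\<close>, which holds because
          \<open>k\<close> and \<open>l\<close> are both at least 2.\<close>
        have "k + (l - Suc d) < k * l"
        proof -
          have "2 \<le> k" using lL l by linarith
          with l obtain a b where "l = 2 + a" "k = 2 + b"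
            by (metis le_Suc_ex)
          then show ?thesis by (simp add: algebra_simps)
        qed
        then show "c d k < k"
          by (simp add: c_def less_mult_imp_div_less)
        show "2 \<le> 2 * l" using l by simp
        have "chain (g ` R d)"
          unfolding chain_def
        proof (clarsimp simp: g_def)
          fix p q p' q' assume R: "(p, q) \<in> R d" "(p', q') \<in> R d"
          have lt: "x div l < y div l \<longleftrightarrow> x < y" if "x mod l = d" "y mod l = d" for x y
          proof -
            have "x < y \<longleftrightarrow> x div l * l + d < y div l * l + d"
              using that by (metis div_mult_mod_eq)
            then show ?thesis using l by simp
          qed
          show "p div l < p' div l \<longleftrightarrow> q div l < q' div l"
            using RD [OF R(1)] RD [OF R(2)] chainD [OF chain] by (simp add: lt)
        qed
        moreover have "g ` R d \<subseteq> {c d i..<c d j} \<times> {c d j..<c d k}"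
        proof (clarsimp simp: g_def)
          fix p q assume R: "(p, q) \<in> R d"
          with sub have "\<not> p < i" "p < j" "\<not> q < j" "q < k" by (auto dest!: RD(1))
          then show "c d i \<le> p div l \<and> p div l < c d j \<and> c d j \<le> q div l \<and> q div l < c d k"
            unfolding cnt [OF RD(3) [OF R]] cnt [OF RD(4) [OF R]] by simp
        qed
        ultimately show "matching (word (2 * l)) (c d i) (c d j) (c d k) (g ` R d)"
          by (auto simp: matching_def g_def dest: RD(2))
      qed
      ultimately show ?thesis by simp
    qed
    have "S = (\<Union>d<l. R d)" using l by (auto simp: R_def)
    then have "card S \<le> (\<Sum>d<l. card (R d))"
      using card_UN_le [of "{..<l}" R] by simp
    then have "2 * l * card S \<le> (\<Sum>d<l. 2 * l * card (R d))"
      by (simp flip: sum_distrib_left)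
    also have "\<dots> \<le> (\<Sum>d<l. 6 * (c d k - c d i))"
      using R by (intro sum_mono) auto
    also have "\<dots> = 6 * ((\<Sum>d<l. c d k) - (\<Sum>d<l. c d i))"
      using lL by (simp add: c_def sum_subtractf_nat div_le_mono flip: sum_distrib_left)
    also have "\<dots> = 6 * (k - i)"
      using l unfolding c_def by (subst (1 2) sum_residue_counts) auto
    finally have "l * card S \<le> 3 * (k - i)" by simp
    moreover have "card M = card D + card S"
    proof -
      have "S \<subseteq> M" by (auto simp: S_def)
      then show ?thesis
        using fin by (simp add: D_def card_Diff_subset card_mono finite_subset)
    qed
    ultimately show ?thesis using D by (simp add: algebra_simps)
  qed simp
qed

section \<open>Edit distance\<close>

text \<open>Follow a common subsequence through the steps: an insertion keeps it, and a deletion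
  costs it at most one symbol while the word also shrinks by one.\<close>

lemma edit_steps_subseq:
  assumes "(edit_step ^^ n) xs ys"
  shows "\<exists>zs. subseq zs xs \<and> subseq zs ys \<and> length xs + length ys \<le> n + 2 * length zs"
  using assms
proof (induction n arbitrary: ys)
  case 0
  then show ?case by (intro exI [of _ xs]) auto
next
  case (Suc n)
  then obtain ws where n: "(edit_step ^^ n) xs ws" and step: "edit_step ws ys"
    by auto
  from Suc.IH [OF n] obtain zs where zs: "subseq zs xs" "subseq zs ws"
    "length xs + length ws \<le> n + 2 * length zs" by auto
  from step obtain us a vs where "ws = us @ vs \<and> ys = us @ a # vs \<or> ws = us @ a # vs \<and> ys = us @ vs"
    unfolding edit_step_def by blast
  then show ?case
  proof (elim disjE conjE)
    assume *: "ws = us @ vs" "ys = us @ a # vs"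
    have "subseq ws ys"
      unfolding * by (intro list_emb_append_mono) auto
    with zs * show ?thesis
      by (intro exI [of _ zs]) (auto intro: subseq_order.trans)
  next
    assume *: "ws = us @ a # vs" "ys = us @ vs"
    with zs(2) obtain z1 z2 where z: "zs = z1 @ z2" "subseq z1 us" "subseq z2 (a # vs)"
      by (auto elim: subseq_appendE)
    obtain z3 where z3: "subseq z3 z2" "subseq z3 vs" "length z2 \<le> Suc (length z3)"
    proof (cases "subseq z2 vs")
      case False
      with z(3) obtain z3 where "z2 = a # z3" "subseq z3 vs"
        by (cases z2) (auto split: if_splits)
      then show ?thesis using that [of z3] by auto
    qed (use that [of z2] in auto)
    have "subseq (z1 @ z3) zs" "subseq (z1 @ z3) ys"
      using z z3 * by (auto intro: list_emb_append_mono)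
    with zs z z3 * show ?thesis
      by (intro exI [of _ "z1 @ z3"]) (auto intro: subseq_order.trans)
  qed
qed

lemma edit_steps_snoc: "(edit_step ^^ length ys) xs (xs @ ys)"
proof (induction ys rule: rev_induct)
  case (snoc a ys)
  have "edit_step (xs @ ys) (xs @ ys @ [a])"
    unfolding edit_step_def by (rule exI [of _ "xs @ ys"]) auto
  with snoc show ?case by auto
qed simp

lemma edit_steps_delete: "(edit_step ^^ length xs) (xs @ ys) ys"
proof (induction xs)
  case (Cons a xs)
  have "edit_step (a # xs @ ys) (xs @ ys)"
    unfolding edit_step_def by (rule exI [of _ "[]"]) auto
  with Cons show ?case by (auto simp del: relpowp.simps intro: relpowp_Suc_I2)
qed simp

text \<open>The \<open>LEAST\<close> in \<open>ED\<close> has a witness: append \<open>ys\<close> at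
  the end, then delete \<open>xs\<close> from the front.\<close>

lemma edit_steps_ED: "(edit_step ^^ ED xs ys) xs ys"
proof -
  have "(edit_step ^^ (length ys + length xs)) xs ys"
    using edit_steps_snoc [of ys xs] edit_steps_delete [of xs ys] by (auto simp: relpowp_add)
  then show ?thesis unfolding ED_def by (rule LeastI)
qed

lemma subseq_map_upt:
  assumes "subseq zs (map f [i..<j])"
  obtains ps where "zs = map f ps" "sorted_wrt (<) ps" "set ps \<subseteq> {i..<j}"
proof -
  obtain N where "zs = nths (map f [i..<j]) N"
    using assms by (auto simp: subseq_conv_nths)
  then have "zs = map f (nths [i..<j] N)"
    by (simp add: nths_map)
  moreover have "sorted_wrt (<) (nths [i..<j] N)"
    by (simp add: strict_sorted_iff sorted_nths)
  moreover have "set (nths [i..<j] N) \<subseteq> {i..<j}"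
    using set_nths_subset [of "[i..<j]" N] by auto
  ultimately show ?thesis by (rule that)
qed

text \<open>The positions that a common subsequence occupies in the two factors, paired in order,
  form a matching of its length.\<close>

lemma ED_adjacent_le:
  assumes "i \<le> j" "j \<le> k"
  shows "\<exists>M. matching f i j k M \<and> k - i \<le> ED (map f [i..<j]) (map f [j..<k]) + 2 * card M"
proof -
  obtain zs where zs: "subseq zs (map f [i..<j])" "subseq zs (map f [j..<k])"
    "length (map f [i..<j]) + length (map f [j..<k]) \<le> ED (map f [i..<j]) (map f [j..<k]) + 2 * length zs"
    using edit_steps_subseq [OF edit_steps_ED] by blast
  obtain ps where ps: "zs = map f ps" "sorted_wrt (<) ps" "set ps \<subseteq> {i..<j}"
    using zs(1) by (rule subseq_map_upt)
  obtain qs where qs: "zs = map f qs" "sorted_wrt (<) qs" "set qs \<subseteq> {j..<k}"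
    using zs(2) by (rule subseq_map_upt)
  have len: "length ps = length zs" "length qs = length zs"
    using ps qs by (metis length_map)+
  have less: "xs ! a < xs ! b \<longleftrightarrow> a < b"
    if "sorted_wrt (<) xs" "a < length xs" "b < length xs" for xs :: "nat list" and a b
    using that by (metis linorder_neqE_nat order_less_asym sorted_wrt_nth_less)
  have "distinct ps"
    using ps(2) by (simp add: strict_sorted_iff)
  then have "card (set (zip ps qs)) = length zs"
    by (simp add: distinct_card distinct_zipI1 len)
  moreover have "matching f i j k (set (zip ps qs))"
    unfolding matching_def chain_def
  proof (intro conjI)
    show "\<forall>(p, q)\<in>set (zip ps qs). \<forall>(p', q')\<in>set (zip ps qs). (p < p') = (q < q')"
      using ps(2) qs(2) by (auto simp: in_set_zip less)
    show "set (zip ps qs) \<subseteq> {i..<j} \<times> {j..<k}"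
      using ps(3) qs(3) by (fastforce dest: set_zip_leftD set_zip_rightD)
    show "\<forall>(p, q)\<in>set (zip ps qs). f p = f q"
      using ps(1) qs(1) by (auto simp: in_set_zip) (metis nth_map)
  qed
  ultimately show ?thesis using zs(3) assms by (intro exI [of _ "set (zip ps qs)"]) simp
qed

section \<open>From matchings to synchronization\<close>

text \<open>The loss is at most twice the matching bound \<open>6 * (k - i) / l\<close>, hence the
  constant 12.\<close>

lemma sync_string_word:
  assumes "0 < \<epsilon>" "12 / \<epsilon> < real l" "2 \<le> l"
  shows "sync_string \<epsilon> (map (word l) [0..<n])"
  unfolding sync_string_def
proof (intro allI impI, elim conjE)
  let ?S = "map (word l) [0..<n]"
  fix i j k assume ijk: "1 \<le> i" "i < j" "j < k" "k \<le> length ?S + 1"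
  have sub: "substr ?S a b = map (word l) [a - 1..<b - 1]" if "1 \<le> a" "a \<le> b" "b \<le> n + 1" for a b
    using that by (simp add: substr_def drop_map take_map)
  obtain M where M: "matching (word l) (i - 1) (j - 1) (k - 1) M"
    "k - 1 - (i - 1) \<le> ED (substr ?S i j) (substr ?S j k) + 2 * card M"
    using ED_adjacent_le [of "i - 1" "j - 1" "k - 1" "word l"] ijk
      sub [of i j] sub [of j k] by fastforce
  have "real (l * card M) \<le> real (6 * (k - i))"
    using card_matching_le [OF assms(3) M(1)] ijk by (subst of_nat_le_iff) simp
  then have "2 * real (card M) \<le> 12 / real l * real (k - i)"
    using assms by (simp add: field_simps)
  also have "\<dots> < \<epsilon> * real (k - i)"
    using assms ijk by (intro mult_strict_right_mono) (auto simp: field_simps)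
  finally have "2 * real (card M) < \<epsilon> * (real k - real i)"
    using ijk by (simp add: of_nat_diff)
  moreover have "real k - real i \<le> real (ED (substr ?S i j) (substr ?S j k)) + 2 * real (card M)"
    using M(2) ijk by linarith
  ultimately show "(1 - \<epsilon>) * (real k - real i) < real (ED (substr ?S i j) (substr ?S j k))"
    by (simp add: algebra_simps)
qed

section \<open>The machine\<close>

definition mem_below :: "nat \<Rightarrow> (nat \<Rightarrow> nat) \<Rightarrow> bool" where
  "mem_below b m \<longleftrightarrow> (\<forall>a. m a < b)"

lemma mem_below_upd: "mem_below b m \<Longrightarrow> mem_below b (m(d := v)) \<longleftrightarrow> v < b"
  by (auto simp: mem_below_def)

text \<open>The bound is checked in all \<open>t + 1\<close> configurations. Recursion from the
  first step lets simplification execute the program instruction by instruction.\<close>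

primrec runs :: "instr list \<Rightarrow> nat \<Rightarrow> nat \<Rightarrow> config \<Rightarrow> config \<Rightarrow> bool" where
  "runs P b 0 c c' \<longleftrightarrow> mem_below b (mem c) \<and> c = c'"
| "runs P b (Suc t) c c' \<longleftrightarrow> mem_below b (mem c) \<and> runs P b t (step P c) c'"

lemma runs_numeral:
  "runs P b (numeral k) c c' \<longleftrightarrow> mem_below b (mem c) \<and> runs P b (pred_numeral k) (step P c) c'"
  by (simp add: numeral_eq_Suc)

lemma runs_trans: "runs P b t c c' \<Longrightarrow> runs P b u c' c'' \<Longrightarrow> runs P b (t + u) c c''"
  by (induction t arbitrary: c) auto

lemma runs_final_below: "runs P b t c c' \<Longrightarrow> mem_below b (mem c')"
  by (induction t arbitrary: c) auto

lemma runs_funpow: "runs P b t c c' \<Longrightarrow> (step P ^^ t) c = c'"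
  by (induction t arbitrary: c) (auto simp: funpow_Suc_right simp del: funpow.simps(2))

lemma runs_below: "runs P b t c c' \<Longrightarrow> s \<le> t \<Longrightarrow> mem_below b (mem ((step P ^^ s) c))"
proof (induction t arbitrary: c s)
  case (Suc t)
  then show ?case
    by (cases s) (auto simp: funpow_Suc_right simp del: funpow.simps(2))
qed simp

text \<open>
  Cell 0 holds the block length \<open>l\<close> of the lowest level and cell 2 the current position \<open>p\<close>. Cell
  \<open>20 + i\<close> holds the current symbol of level \<open>i\<close>, all of them 0 initially; the current digit is this
  symbol modulo the block length. Cells 6 and 7 hold the address and block length of the level at
  work, cells 8 to 12 are scratch. The loop at 11 climbs while a carry occurs, 22 increments the
  digit where it stops, and the loop at 32 descends, entering digit 0.
\<close>

definition sync_program :: "instr list" where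
  "sync_program =
    [Const 3 1, Const 4 20, Const 5 2, Const 6 13, Mul 0 0 6,
     JumpLess 2 1 7, Jump 44,
     Print 20, Add 2 2 3, Copy 6 4, Copy 7 0,
     Load 8 6, Add 9 6 3, Load 11 9, Div 10 8 7, Mul 10 10 7, Sub 10 8 10, Add 10 10 3,
     JumpLess 10 7 22,
     Copy 6 9, Add 7 7 7, Jump 11,
     Add 12 7 7, Mul 12 12 12, Mul 12 12 12,
     Div 10 11 12, Mul 10 10 12, Sub 10 11 10, Mul 10 10 7, Add 10 10 3, Add 8 8 10, Store 6 8,
     JumpLess 4 6 34, Jump 5,
     Load 11 6, Sub 6 6 3, Div 7 7 5, Add 12 7 7, Mul 12 12 12, Mul 12 12 12,
     Div 10 11 12, Mul 10 10 7, Store 6 10, Jump 32]"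

lemma length_sync_program: "length sync_program = 44"
  by (simp add: sync_program_def)

lemma step_sync_program:
  "p < 44 \<Longrightarrow> step sync_program (Config p m os) = exec (sync_program ! p) (Config p m os)"
  by (simp add: step_def halted_def length_sync_program)

lemmas sync_program_nth = arg_cong [OF sync_program_def, of "\<lambda>P. P ! k" for k]

lemmas symbolic_execution =
  runs_numeral step_sync_program sync_program_nth mem_below_upd

section \<open>Symbolic execution of the loops\<close>

text \<open>One carry. Cell \<open>A\<close> keeps its old symbol and is rewritten during the
  descent; \<open>20 \<le> A\<close> separates level cells from work cells.\<close>

lemma run_up_carry:
  assumes "mem_below b m" "m 3 = Suc 0" "m 6 = A" "m 7 = l"
    and "20 \<le> A" "Suc A < b" "2 * l < b" and carry: "Suc (m A mod l) = l"
  shows "\<exists>m'. runs sync_program b 11 (Config 11 m os) (Config 11 m' os) \<and>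
    m' 6 = Suc A \<and> m' 7 = 2 * l \<and> (\<forall>a. a \<notin> {6..12} \<longrightarrow> m' a = m a)"
proof -
  have lt: "m a < b" for a using assms(1) by (simp add: mem_below_def)
  have le: "m A div l < b" "m A div l * l < b" "m A mod l < b" "l < b" "l + l < b"
    using lt [of A] assms(7) carry
    by (auto intro: le_less_trans [OF div_le_dividend] le_less_trans [OF div_times_less_eq_dividend])
  have ne: "A \<noteq> 5" "A \<noteq> 6" "A \<noteq> 7" "A \<noteq> 8" "A \<noteq> 9" "A \<noteq> 10" "A \<noteq> 11" "A \<noteq> 12"
    using assms(5) by auto
  show ?thesis
    using carry by (simp add: symbolic_execution assms(1-4,6) lt le ne minus_div_mult_eq_mod)
qed

text \<open>Raising a digit by one adds 1 to the offset and the slope to the value, so the code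
  grows by 1 plus \<open>l\<close> times the slope; the slope is the symbol above modulo
  \<open>(2 * l) ^ 4\<close>.\<close>

lemma run_up_stop:
  assumes "mem_below b m" "m 3 = Suc 0" "m 6 = A" "m 7 = l"
    and "20 \<le> A" "Suc A < b" "2 \<le> l" "(2 * l) ^ 4 < b" and stop: "Suc (m A mod l) < l"
    and "m A + Suc (m (Suc A) mod (2 * l) ^ 4 * l) < b"
  shows "\<exists>m'. runs sync_program b 18 (Config 11 m os) (Config 32 m' os) \<and>
    m' 6 = A \<and> m' 7 = l \<and> m' A = m A + Suc (m (Suc A) mod (2 * l) ^ 4 * l) \<and>
    (\<forall>a. a \<notin> {6..12} \<and> a \<noteq> A \<longrightarrow> m' a = m a)"
proof -
  define B where "B = (2 * l) ^ 4"
  have B: "(l + l) * (l + l) * ((l + l) * (l + l)) = B"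
    unfolding B_def by algebra
  have l: "l + l \<le> (l + l) * (l + l)" "(l + l) * (l + l) \<le> B"
    unfolding B [symmetric] by simp_all
  have lt: "m a < b" for a using assms(1) by (simp add: mem_below_def)
  have B_lt: "B < b" using assms(8) unfolding B_def .
  with l have l_lt: "l < b" "l + l < b" "(l + l) * (l + l) < b" by linarith+
  then have "Suc (m A mod l) < b" using stop by linarith
  have le: "m A div l < b" "m A div l * l < b" "m A mod l < b"
      "m (Suc A) div B < b" "m (Suc A) div B * B < b"  "m (Suc A) mod B < b"
    using lt [of A] lt [of "Suc A"]
    by (auto intro: le_less_trans [OF div_le_dividend] le_less_trans [OF div_times_less_eq_dividend]
       le_less_trans [OF mod_less_eq_dividend])
  have ne: "A \<noteq> 5" "A \<noteq> 6" "A \<noteq> 7" "A \<noteq> 8" "A \<noteq> 9" "A \<noteq> 10" "A \<noteq> 11" "A \<noteq> 12"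
    using assms(5) by auto
  have b: "m A + Suc (m (Suc A) mod B * l) < b"
    using assms(10) unfolding B_def .
  show ?thesis unfolding B_def [symmetric]
    using stop b by (simp add: symbolic_execution assms(1-4,6) lt le ne B B_lt l_lt \<open>Suc (m A mod l) < b\<close>
        minus_div_mult_eq_mod)
qed

text \<open>At digit 0 only the constant coefficient of the symbol above contributes to the
  code.\<close>

lemma run_down:
  assumes "mem_below b m" "m 3 = Suc 0" "m 4 = 20" "m 5 = 2" "m 6 = Suc A" "m 7 = 2 * l"
    and "20 \<le> A" "(2 * l) ^ 4 < b" "m (Suc A) div (2 * l) ^ 4 * l < b"
  shows "\<exists>m'. runs sync_program b 11 (Config 32 m os) (Config 32 m' os) \<and>
    m' 6 = A \<and> m' 7 = l \<and> m' A = m (Suc A) div (2 * l) ^ 4 * l \<and>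
    (\<forall>a. a \<notin> {6..12} \<and> a \<noteq> A \<longrightarrow> m' a = m a)"
proof -
  define B where "B = (2 * l) ^ 4"
  have B: "(l + l) * (l + l) * ((l + l) * (l + l)) = B"
    unfolding B_def by algebra
  have l: "l + l \<le> (l + l) * (l + l)" "(l + l) * (l + l) \<le> B"
    unfolding B [symmetric] by simp_all
  have lt: "m a < b" for a using assms(1) by (simp add: mem_below_def)
  have B_lt: "B < b" using assms(8) unfolding B_def .
  with l have l_lt: "l < b" "l + l < b" "(l + l) * (l + l) < b" by linarith+
  have le: "A < b" "m (Suc A) div B < b"
    using lt [of 6] lt [of "Suc A"] assms(5) by (auto intro: le_less_trans [OF div_le_dividend])
  have ne: "A \<noteq> 5" "A \<noteq> 6" "A \<noteq> 7" "A \<noteq> 8" "A \<noteq> 9" "A \<noteq> 10" "A \<noteq> 11" "A \<noteq> 12"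
    using assms(7) by auto
  have b: "m (Suc A) div B * l < b"
    using assms(9) unfolding B_def .
  show ?thesis unfolding B_def [symmetric]
    using b assms(7) by (simp add: symbolic_execution assms(1-6) lt le ne B B_lt l_lt)
qed

lemma run_down_exit:
  "mem_below b m \<Longrightarrow> m 4 = 20 \<Longrightarrow> m 6 = 20 \<Longrightarrow>
   runs sync_program b 2 (Config 32 m os) (Config 5 m os)"
  by (simp add: symbolic_execution)

lemma run_print:
  assumes "mem_below b m" "m 2 < m 1" "m 3 = Suc 0" "m 4 = 20"
  shows "\<exists>m'. runs sync_program b 5 (Config 5 m os) (Config 11 m' (os @ [m 20])) \<and>
    m' 2 = Suc (m 2) \<and> m' 6 = 20 \<and> m' 7 = m 0 \<and> (\<forall>a. a \<notin> {2, 6, 7} \<longrightarrow> m' a = m a)"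
proof -
  have lt: "m a < b" for a using assms(1) by (simp add: mem_below_def)
  from lt [of 4] lt [of 1] assms(2,4) have "Suc (m 2) < b" "20 < b" by linarith+
  then show ?thesis
    using assms by (simp add: symbolic_execution lt)
qed

lemma run_exit:
  "mem_below b m \<Longrightarrow> m 1 \<le> m 2 \<Longrightarrow> runs sync_program b 2 (Config 5 m os) (Config 44 m os)"
  by (simp add: symbolic_execution)

lemma run_init:
  assumes "E < b" "n < b" "20 < b" "13 * E < b"
  shows "\<exists>m. runs sync_program b 5 (init_config [E, n]) (Config 5 m []) \<and>
    m 0 = 13 * E \<and> m 1 = n \<and> m 2 = 0 \<and> m 3 = 1 \<and> m 4 = 20 \<and> m 5 = 2 \<and> (\<forall>a\<ge>20. m a = 0)"
proof -
  define m where "m = (\<lambda>a. if a < length [E, n] then [E, n] ! a else 0)"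
  have "mem_below b m" "m 0 = E" "m 1 = n" "m 2 = 0" "\<And>a. a \<ge> 20 \<Longrightarrow> m a = 0"
    using assms by (auto simp: m_def mem_below_def less_Suc_eq)
  then show ?thesis
    unfolding init_config_def m_def [symmetric]
    using assms by (simp add: symbolic_execution mult.commute)
qed

text \<open>\<open>level_symbol l p i\<close> is the content of cell \<open>20 + i\<close> at position \<open>p\<close>.\<close>

primrec level_symbol :: "nat \<Rightarrow> nat \<Rightarrow> nat \<Rightarrow> nat" where
  "level_symbol l p 0 = word l p"
| "level_symbol l p (Suc i) = level_symbol (2 * l) (p div l) i"

section \<open>Mixed-radix digits and amortized carries\<close>

text \<open>For \<open>2 \<le> l\<close> this is the number of trailing maximal digits of
  \<open>p\<close> in the mixed radix \<open>l, 2 * l, 4 * l, ...\<close>. A maximal digit is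
  nonzero, so \<open>p > 0\<close> and the recursion terminates.\<close>

function carries :: "nat \<Rightarrow> nat \<Rightarrow> nat" where
  "carries l p = (if 2 \<le> l \<and> Suc (p mod l) = l then Suc (carries (2 * l) (p div l)) else 0)"
  by auto
termination by (relation "measure snd") (auto intro!: div_less_dividend Nat.gr0I)

declare carries.simps [simp del]

function nonzero_digits :: "nat \<Rightarrow> nat \<Rightarrow> nat" where
  "nonzero_digits l p =
    (if l < 2 \<or> p = 0 then 0 else of_bool (p mod l \<noteq> 0) + nonzero_digits (2 * l) (p div l))"
  by auto
termination by (relation "measure snd") auto

declare nonzero_digits.simps [simp del]

lemma level_symbol_0 [simp]: "level_symbol l 0 i = 0"
  by (induction i arbitrary: l) auto

lemma nonzero_digits_0 [simp]: "nonzero_digits l 0 = 0"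
  by (simp add: nonzero_digits.simps)

lemma nonzero_digits_rec:
  "2 \<le> l \<Longrightarrow> nonzero_digits l p = of_bool (p mod l \<noteq> 0) + nonzero_digits (2 * l) (p div l)"
  by (cases "p = 0") (simp_all add: nonzero_digits.simps [of l p])

text \<open>Each carry turns a maximal, hence nonzero, digit into 0, and only the digit where the
  carries stop can become nonzero.\<close>

lemma carries_amortized:
  "2 \<le> l \<Longrightarrow> carries l p + nonzero_digits l (Suc p) \<le> Suc (nonzero_digits l p)"
proof (induction l p rule: carries.induct)
  case (1 l p)
  note rec = nonzero_digits_rec [OF 1(2), of p] nonzero_digits_rec [OF 1(2), of "Suc p"]
  show ?case
  proof (cases "Suc (p mod l) = l")
    case True
    with 1 have "carries (2 * l) (p div l) + nonzero_digits (2 * l) (Suc (p div l))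
        \<le> Suc (nonzero_digits (2 * l) (p div l))" by simp
    moreover have "p mod l \<noteq> 0" using True 1(2) by auto
    ultimately show ?thesis
      using True 1(2) unfolding rec by (simp add: carries.simps [of l p] mod_Suc div_Suc)
  next
    case False
    then show ?thesis
      unfolding rec by (simp add: carries.simps [of l p] mod_Suc div_Suc)
  qed
qed

text \<open>If the lowest digit is maximal, then \<open>Suc p = l * Suc (p div l)\<close>, so every
  carry contributes a factor of at least 2. This bounds the block lengths that the machine
  handles.\<close>

lemma power_carries_le: "2 ^ carries l p \<le> Suc p"
proof (induction l p rule: carries.induct)
  case (1 l p)
  show ?case
  proof (cases "2 \<le> l \<and> Suc (p mod l) = l")
    case True
    with 1 have "2 ^ carries l p \<le> 2 * Suc (p div l)"
      by (simp add: carries.simps [of l p])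
    also have "\<dots> \<le> l * Suc (p div l)"
      using True by (intro mult_right_mono) auto
    also have "\<dots> = l * (p div l) + Suc (p mod l)"
      using True by simp
    also have "\<dots> = Suc p" by simp
    finally show ?thesis .
  qed (auto simp: carries.simps [of l p])
qed

lemma word_Suc_carry:
  assumes "2 \<le> l" "Suc (p mod l) = l"
  shows "word l (Suc p) = word (2 * l) (Suc (p div l)) div (2 * l) ^ 4 * l"
  using assms by (simp add: word_rec [of l "Suc p"] enc_def mod_Suc div_Suc mult.commute)

lemma word_Suc_no_carry:
  assumes "2 \<le> l" "Suc (p mod l) < l"
  shows "word l (Suc p) = word l p + Suc (word (2 * l) (p div l) mod (2 * l) ^ 4 * l)"
  using assms unfolding word_rec [OF assms(1), of "Suc p"] word_rec [OF assms(1), of p]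
  by (simp add: enc_def mod_Suc div_Suc algebra_simps)

section \<open>Correctness, running time and word length\<close>

text \<open>Each carry costs 11 steps up and 11 down, the stop 18. The highest level reached has
  block length \<open>l * 2 ^ carries l p\<close>, so the last assumption covers the symbols and
  fourth powers of all levels reached.\<close>

lemma run_increment:
  assumes "mem_below b m" "m 3 = 1" "m 4 = 20" "m 5 = 2" "m 6 = A" "m 7 = l"
    and "4 \<le> l" "20 \<le> A" "\<And>i. m (A + i) = level_symbol l p i"
    and "A + carries l p + 1 < b" "(2 * l * 2 ^ carries l p) ^ 8 \<le> b"
  shows "\<exists>t m'. runs sync_program b t (Config 11 m os) (Config 32 m' os) \<and>
    t \<le> 18 + 22 * carries l p \<and> m' 6 = A \<and> m' 7 = l \<and>
    (\<forall>i. m' (A + i) = level_symbol l (Suc p) i) \<and> (\<forall>a<A. a \<notin> {6..12} \<longrightarrow> m' a = m a)"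
  using assms
proof (induction l p arbitrary: A m rule: carries.induct)
  case (1 l p)
  note m = 1(2-7) and l = 1(8) and A = 1(9) and sym = 1(10) and b = 1(11,12)
  have l2: "2 \<le> l" using l by simp
  have symA: "m A = word l p" and symA': "m (Suc A) = word (2 * l) (p div l)"
    using sym [of 0] sym [of 1] by simp_all
  have "2 * l * 1 \<le> 2 * l * 2 ^ carries l p"
    by (intro mult_left_mono) auto
  then have "(2 * l) ^ 8 \<le> (2 * l * 2 ^ carries l p) ^ 8"
    by (intro power_mono) auto
  with b(2) have lb: "(2 * l) ^ 8 \<le> b" by linarith
  moreover have "(2 * l) ^ 4 < (2 * l) ^ 8" "(2 * l) ^ 1 < (2 * l) ^ 8"
    using l by (intro power_strict_increasing; simp)+
  moreover have "l ^ 8 \<le> (2 * l) ^ 8" by (intro power_mono) auto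
  ultimately have small: "(2 * l) ^ 4 < b" "2 * l < b" "word l q < b" for q
    using word_less [OF l, of q] by (simp, simp, linarith)
  have modA: "m A mod l = p mod l"
    using symA l2 by (simp add: word_mod)
  show ?case
  proof (cases "Suc (p mod l) = l")
    case carry: True
    then have car: "carries l p = Suc (carries (2 * l) (p div l))"
      using l by (simp add: carries.simps [of l p])
    obtain m1 where run1: "runs sync_program b 11 (Config 11 m os) (Config 11 m1 os)"
      and m1: "m1 6 = Suc A" "m1 7 = 2 * l" and same1: "\<And>a. a \<notin> {6..12} \<Longrightarrow> m1 a = m a"
      using run_up_carry [of b m A l os] m A b small carry modA by auto
    have "\<exists>t m'. runs sync_program b t (Config 11 m1 os) (Config 32 m' os) \<and>
      t \<le> 18 + 22 * carries (2 * l) (p div l) \<and> m' 6 = Suc A \<and> m' 7 = 2 * l \<and>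
      (\<forall>i. m' (Suc A + i) = level_symbol (2 * l) (Suc (p div l)) i) \<and>
      (\<forall>a<Suc A. a \<notin> {6..12} \<longrightarrow> m' a = m1 a)"
    proof (rule 1(1))
      show "2 \<le> l \<and> Suc (p mod l) = l" using l2 carry by simp
      show "mem_below b m1" using runs_final_below [OF run1] by simp
      show "m1 (Suc A + i) = level_symbol (2 * l) (p div l) i" for i
        using sym [of "Suc i"] A by (simp add: same1)
      show "(2 * (2 * l) * 2 ^ carries (2 * l) (p div l)) ^ 8 \<le> b"
        using b(2) unfolding car by (simp add: mult.assoc mult.left_commute)
    qed (use m m1 A l b same1 car in auto)
    then obtain t m2 where run2: "runs sync_program b t (Config 11 m1 os) (Config 32 m2 os)"
      and t: "t \<le> 18 + 22 * carries (2 * l) (p div l)" and m2: "m2 6 = Suc A" "m2 7 = 2 * l"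
      and sym2: "\<And>i. m2 (Suc A + i) = level_symbol (2 * l) (Suc (p div l)) i"
      and same2: "\<And>a. a < Suc A \<Longrightarrow> a \<notin> {6..12} \<Longrightarrow> m2 a = m1 a"
      by blast
    have val: "m2 (Suc A) div (2 * l) ^ 4 * l = word l (Suc p)"
      using sym2 [of 0] word_Suc_carry [OF l2 carry] by simp
    obtain m3 where run3: "runs sync_program b 11 (Config 32 m2 os) (Config 32 m3 os)"
      and m3: "m3 6 = A" "m3 7 = l" "m3 A = word l (Suc p)"
      and same3: "\<And>a. a \<notin> {6..12} \<Longrightarrow> a \<noteq> A \<Longrightarrow> m3 a = m2 a"
      using run_down [of b m2 A l os] runs_final_below [OF run2] m2 m A small val
      by (auto simp: same1 same2)
    have "level_symbol l (Suc p) i = m3 (A + i)" for i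
      using sym2 [of "i - 1"] m3(3) A l2 carry
      by (cases i) (auto simp: same3 div_Suc mod_Suc)
    moreover have "m3 a = m a" if "a < A" "a \<notin> {6..12}" for a
      using that same1 same2 same3 by simp
    moreover have "runs sync_program b (11 + t + 11) (Config 11 m os) (Config 32 m3 os)"
      using run1 run2 run3 by (blast intro: runs_trans)
    ultimately show ?thesis
      using m3 t car by (intro exI [of _ "11 + t + 11"] exI [of _ m3]) auto
  next
    case False
    moreover have "p mod l < l" using l by simp
    ultimately have stop: "Suc (p mod l) < l" by linarith
    have val: "m A + Suc (m (Suc A) mod (2 * l) ^ 4 * l) = word l (Suc p)"
      unfolding symA symA' using word_Suc_no_carry [OF l2 stop] by simp
    obtain m1 where run1: "runs sync_program b 18 (Config 11 m os) (Config 32 m1 os)"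
      and m1: "m1 6 = A" "m1 7 = l" "m1 A = word l (Suc p)"
      and same1: "\<And>a. a \<notin> {6..12} \<Longrightarrow> a \<noteq> A \<Longrightarrow> m1 a = m a"
      using run_up_stop [of b m A l os] m A b l2 small stop modA val by auto
    have "level_symbol l (Suc p) i = m1 (A + i)" for i
      using sym [of i] m1(3) A l2 stop
      by (cases i) (auto simp: same1 div_Suc mod_Suc)
    then show ?thesis
      using run1 m1 same1 by (intro exI [of _ 18] exI [of _ m1]) auto
  qed
qed

text \<open>With potential \<open>22 * nonzero_digits\<close>, a symbol costs 5 steps for printing,
  18 + 22 for the increment and 2 for the return, 47 in total. Addresses stay within
  \<open>n + 21\<close> because there are at most \<open>n\<close> carries.\<close>

lemma run_loop:
  assumes b: "E < b" "n + 21 < b" "(26 * E * Suc n) ^ 8 \<le> b" and E: "1 \<le> E" and "p \<le> n"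
  shows "\<exists>t m. runs sync_program b t (init_config [E, n])
      (Config 5 m (map (word (13 * E)) [0..<p])) \<and>
    t + 22 * nonzero_digits (13 * E) p \<le> 5 + 47 * p \<and>
    m 0 = 13 * E \<and> m 1 = n \<and> m 2 = p \<and> m 3 = 1 \<and> m 4 = 20 \<and> m 5 = 2 \<and>
    (\<forall>i. m (20 + i) = level_symbol (13 * E) p i)"
  using \<open>p \<le> n\<close>
proof (induction p)
  case 0
  have "13 * E < (26 * E * Suc n) ^ 1" using E by simp
  also have "\<dots> \<le> (26 * E * Suc n) ^ 8"
    using E by (intro power_increasing) auto
  finally have "13 * E < b" using b(3) by linarith
  with run_init [of E b n] b show ?case
    by (auto intro!: exI [of _ 5])
next
  case (Suc p)
  let ?l = "13 * E"
  from Suc obtain t m where run: "runs sync_program b t (init_config [E, n])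
      (Config 5 m (map (word ?l) [0..<p]))"
    and t: "t + 22 * nonzero_digits ?l p \<le> 5 + 47 * p"
    and m: "m 0 = ?l" "m 1 = n" "m 2 = p" "m 3 = 1" "m 4 = 20" "m 5 = 2"
    and sym: "\<And>i. m (20 + i) = level_symbol ?l p i"
    by auto
  have out: "map (word ?l) [0..<p] @ [m 20] = map (word ?l) [0..<Suc p]"
    using sym [of 0] by simp
  obtain m1 where run1: "runs sync_program b 5 (Config 5 m (map (word ?l) [0..<p]))
      (Config 11 m1 (map (word ?l) [0..<Suc p]))"
    and m1: "m1 2 = Suc p" "m1 6 = 20" "m1 7 = ?l"
    and same1: "\<And>a. a \<notin> {2, 6, 7} \<Longrightarrow> m1 a = m a"
    using run_print [of b m "map (word ?l) [0..<p]"] runs_final_below [OF run] m Suc.prems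
    unfolding out by auto
  define c where "c = carries ?l p"
  have pow: "2 ^ c \<le> Suc p" unfolding c_def by (rule power_carries_le)
  then have "c \<le> n" using less_exp [of c] Suc.prems by linarith
  have "26 * E * 2 ^ c \<le> 26 * E * Suc n"
    using pow Suc.prems by (intro mult_le_mono2) linarith
  then have "(2 * ?l * 2 ^ c) ^ 8 \<le> (26 * E * Suc n) ^ 8"
    by (intro power_mono) auto
  with b(3) have "(2 * ?l * 2 ^ c) ^ 8 \<le> b" by linarith
  then obtain u m2 where run2: "runs sync_program b u (Config 11 m1 (map (word ?l) [0..<Suc p]))
      (Config 32 m2 (map (word ?l) [0..<Suc p]))"
    and u: "u \<le> 18 + 22 * c" and m2: "m2 6 = 20"
    and sym2: "\<And>i. m2 (20 + i) = level_symbol ?l (Suc p) i"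
    and same2: "\<And>a. a < 20 \<Longrightarrow> a \<notin> {6..12} \<Longrightarrow> m2 a = m1 a"
    using run_increment [of b m1 20 ?l p "map (word ?l) [0..<Suc p]", folded c_def]
      runs_final_below [OF run1] m m1 sym E b(2) \<open>c \<le> n\<close> by (auto simp: same1)
  have run3: "runs sync_program b 2 (Config 32 m2 (map (word ?l) [0..<Suc p]))
      (Config 5 m2 (map (word ?l) [0..<Suc p]))"
    using runs_final_below [OF run2] m m2 by (intro run_down_exit) (auto simp: same1 same2)
  have "runs sync_program b (t + (5 + (u + 2))) (init_config [E, n])
      (Config 5 m2 (map (word ?l) [0..<Suc p]))"
    using run run1 run2 run3 by (blast intro: runs_trans)
  moreover have "t + (5 + (u + 2)) + 22 * nonzero_digits ?l (Suc p) \<le> 5 + 47 * Suc p"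
    using t u carries_amortized [of ?l p] E unfolding c_def by simp
  ultimately show ?case
    using m m1 sym2
    by (intro exI [of _ "t + (5 + (u + 2))"] exI [of _ m2]) (simp add: same1 same2)
qed

lemma ram_computesI:
  assumes "runs P (2 ^ w) t (init_config xs) (Config p m ys)" "length P \<le> p" "t \<le> T"
  shows "ram_computes P xs ys T w"
  unfolding ram_computes_def
  using assms runs_funpow [OF assms(1)] runs_below [OF assms(1)]
  by (intro exI [of _ t]) (auto simp: halted_def mem_below_def)

lemma ram_computes_word:
  assumes "E < 2 ^ w" "n + 21 < 2 ^ w" "(26 * E * Suc n) ^ 8 \<le> 2 ^ w" "1 \<le> E"
  shows "ram_computes sync_program [E, n] (map (word (13 * E)) [0..<n]) (7 + 47 * n) w"
proof -
  obtain t m where run: "runs sync_program (2 ^ w) t (init_config [E, n])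
      (Config 5 m (map (word (13 * E)) [0..<n]))"
    and t: "t + 22 * nonzero_digits (13 * E) n \<le> 5 + 47 * n" and m: "m 1 = n" "m 2 = n"
    using run_loop [OF assms order_refl] by auto
  have "runs sync_program (2 ^ w) (t + 2) (init_config [E, n])
      (Config 44 m (map (word (13 * E)) [0..<n]))"
    using runs_trans [OF run run_exit] runs_final_below [OF run] m by simp
  then show ?thesis
    by (rule ram_computesI) (use t in \<open>simp_all add: length_sync_program\<close>)
qed

theorem theorem4p7:
  "\<exists>(P :: instr list) (C :: real) (c :: nat).
     \<forall>\<epsilon> :: real. 0 < \<epsilon> \<and> \<epsilon> < 1 \<longrightarrow>
       (\<exists>(A :: nat) (T :: nat \<Rightarrow> nat) (w :: nat \<Rightarrow> nat).
          real A \<le> C * (1 / \<epsilon>) ^ c \<and>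
          (\<lambda>n. real (T n)) \<in> O(\<lambda>n. real n) \<and>
          (\<lambda>n. real (w n)) \<in> O(\<lambda>n. ln (real n)) \<and>
          (\<forall>n. \<exists>S :: nat list.
             ram_computes P (sync_input \<epsilon> n) S (T n) (w n) \<and>
             length S = n \<and> set S \<subseteq> {..<A} \<and> sync_string \<epsilon> S))"
proof (rule exI [of _ sync_program], rule exI [of _ "26 ^ 8"], rule exI [of _ 8], intro allI impI)
  fix \<epsilon> :: real assume \<epsilon>: "0 < \<epsilon> \<and> \<epsilon> < 1"
  define E where "E = nat \<lceil>1 / \<epsilon>\<rceil>"
  have E_ge: "1 / \<epsilon> \<le> real E" unfolding E_def by (rule real_nat_ceiling_ge)
  have "1 < 1 / \<epsilon>" using \<epsilon> by simp
  with E_ge have E1: "1 \<le> E" by linarith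
  \<comment> \<open>Since \<open>1 / \<epsilon>\<close> exceeds 1, rounding up at most doubles it;
    this turns the 13 of the block length into the 26 of the alphabet bound.\<close>
  have "real E \<le> 2 * (1 / \<epsilon>)" using \<open>1 < 1 / \<epsilon>\<close> unfolding E_def by linarith
  then have "(13 * real E) ^ 8 \<le> (26 * (1 / \<epsilon>)) ^ 8"
    by (intro power_mono) auto
  then have A: "real ((13 * E) ^ 8) \<le> 26 ^ 8 * (1 / \<epsilon>) ^ 8"
    by (simp only: power_mult_distrib of_nat_power of_nat_mult of_nat_numeral)
  \<comment> \<open>\<open>26 * E * (n + 22)\<close> dominates \<open>E\<close>,
    \<open>n + 21\<close> and \<open>26 * E * Suc n\<close>; the eighth power of the last one
    explains the word length \<open>8 * k n\<close>.\<close>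
  define k where "k n = nat \<lceil>log 2 (real (26 * E * (n + 22)))\<rceil>" for n
  have k: "26 * E * (n + 22) \<le> 2 ^ k n" for n
  proof -
    have "real (26 * E * (n + 22)) = 2 powr log 2 (real (26 * E * (n + 22)))"
      using E1 by simp
    also have "\<dots> \<le> 2 powr real (k n)"
      unfolding k_def by (intro powr_mono real_nat_ceiling_ge) auto
    also have "\<dots> = real (2 ^ k n)"
      by (simp add: powr_realpow)
    finally show ?thesis by (simp only: of_nat_le_iff)
  qed
  have computes: "ram_computes sync_program [E, n] (map (word (13 * E)) [0..<n]) (7 + 47 * n) (8 * k n)"
    for n
  proof (rule ram_computes_word)
    have "(2::nat) ^ k n \<le> 2 ^ (8 * k n)" by (intro power_increasing) auto
    with k [of n] have X: "26 * E * (n + 22) \<le> 2 ^ (8 * k n)" by (rule order_trans)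
    have "E < 26 * E * 22" using E1 by simp
    also have "\<dots> \<le> 26 * E * (n + 22)" by (rule mult_le_mono2) simp
    also note X
    finally show "E < 2 ^ (8 * k n)" .
    have "n + 21 < 26 * 1 * (n + 22)" by simp
    also have "\<dots> \<le> 26 * E * (n + 22)" using E1 by (intro mult_le_mono) auto
    also note X
    finally show "n + 21 < 2 ^ (8 * k n)" .
    have "26 * E * Suc n \<le> 26 * E * (n + 22)" by (rule mult_le_mono2) simp
    also note k [of n]
    finally have "(26 * E * Suc n) ^ 8 \<le> (2 ^ k n) ^ 8" by (intro power_mono) auto
    then show "(26 * E * Suc n) ^ 8 \<le> 2 ^ (8 * k n)"
      by (simp only: power_mult [symmetric] mult.commute [of "k n"])
  qed (rule E1)
  have wlim: "(\<lambda>n. real (8 * k n)) \<in> O(\<lambda>n. ln (real n))"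
  proof -
    have "(\<lambda>n. real (8 * k n)) \<in> O(\<lambda>n. 8 * (log 2 (real (26 * E * (n + 22))) + 1))"
    proof (intro landau_o.big_mono always_eventually allI)
      fix n
      have "1 \<le> 26 * E * (n + 22)" using E1 by (simp add: Suc_le_eq)
      then have "1 \<le> real (26 * E * (n + 22))" by (metis of_nat_1 of_nat_le_iff)
      then have "0 \<le> log 2 (real (26 * E * (n + 22)))" by (simp del: of_nat_mult)
      moreover from this have "real (k n) \<le> log 2 (real (26 * E * (n + 22))) + 1"
        unfolding k_def by linarith
      ultimately show "norm (real (8 * k n)) \<le> norm (8 * (log 2 (real (26 * E * (n + 22))) + 1))"
        by (simp del: of_nat_mult add: of_nat_mult [of 8])
    qed
    also have "(\<lambda>n. 8 * (log 2 (real (26 * E * (n + 22))) + 1)) \<in> O(\<lambda>n. ln (real n))"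
      using E1 by real_asymp
    finally show ?thesis .
  qed
  have T: "(\<lambda>n. real (7 + 47 * n)) \<in> O(\<lambda>n. real n)"
    by real_asymp
  have sync: "sync_string \<epsilon> (map (word (13 * E)) [0..<n])" for n
  proof (rule sync_string_word)
    \<comment> \<open>The factor 13 in the block length \<open>13 * E\<close> makes the required
      inequality strict.\<close>
    have "12 / \<epsilon> < 13 * (1 / \<epsilon>)" using \<epsilon> by (simp add: field_simps)
    with E_ge show "12 / \<epsilon> < real (13 * E)" by simp
  qed (use \<epsilon> E1 in auto)
  have alphabet: "set (map (word (13 * E)) [0..<n]) \<subseteq> {..<(13 * E) ^ 8}" for n
    using word_less [of "13 * E"] E1 by auto
  show "\<exists>(A :: nat) (T :: nat \<Rightarrow> nat) (w :: nat \<Rightarrow> nat).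
      real A \<le> 26 ^ 8 * (1 / \<epsilon>) ^ 8 \<and> (\<lambda>n. real (T n)) \<in> O(\<lambda>n. real n) \<and>
      (\<lambda>n. real (w n)) \<in> O(\<lambda>n. ln (real n)) \<and>
      (\<forall>n. \<exists>S. ram_computes sync_program (sync_input \<epsilon> n) S (T n) (w n) \<and>
        length S = n \<and> set S \<subseteq> {..<A} \<and> sync_string \<epsilon> S)"
  proof (rule exI [of _ "(13 * E) ^ 8"], rule exI [of _ "\<lambda>n. 7 + 47 * n"],
      rule exI [of _ "\<lambda>n. 8 * k n"], intro conjI allI)
    fix n
    show "\<exists>S. ram_computes sync_program (sync_input \<epsilon> n) S (7 + 47 * n) (8 * k n) \<and>
        length S = n \<and> set S \<subseteq> {..<(13 * E) ^ 8} \<and> sync_string \<epsilon> S"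
      unfolding sync_input_def E_def [symmetric] using computes [of n] sync alphabet
      by (intro exI [of _ "map (word (13 * E)) [0..<n]"]) simp
  qed (fact A T wlim)+
qed

end
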